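(* Let $(X,\mathcal{T})$ be a continuum and let $f:X\to X$ be a continuous map. Then there exists a continuum $K\subseteq X$ such that $f(K)=K$.
   Context: A continuum is a non-empty compact connected Hausdorff space; a subset $K\subseteq X$ is a continuum if it is one with the subspace topology. *)

theory Defs
  imports "HOL-Analysis.Analysis"
begin

(* Metrizability is not required, and one-point spaces count as continua. *)
definition continuum_space :: "'a topology \<Rightarrow> bool" where
  "continuum_space X \<longleftrightarrow>
     topspace X \<noteq> {} \<and> compact_space X \<and> connected_space X \<and> Hausdorff_space X"

(* The condition K \<subseteq> topspace X is needed because subtopology X K silently
   replaces K by its intersection with topspace X. *)
definition continuumin :: "'a topology \<Rightarrow> 'a set \<Rightarrow> bool" where
  "continuumin X K \<longleftrightarrow> K \<subseteq> topspace X \<and> continuum_space (subtopology X K)"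

end

theory Submission
  imports Defs
begin

text \<open>
  Among the subcontinua \<open>K\<close> that \<open>f\<close> maps into themselves, choose a minimal one.  Its image \<open>f ` K\<close>
  is again a subcontinuum mapped into itself and lies in \<open>K\<close>, so minimality forces \<open>f ` K = K\<close>.

  A minimal \<open>K\<close> exists by Zorn's lemma once intersections of chains of invariant subcontinua are
  invariant subcontinua.  Everything there rests on one consequence of compactness
  (\<open>compact_chain_Inter_subset_open\<close>): a chain of closed sets whose intersection lies in an
  open set \<open>W\<close> already has a member inside \<open>W\<close>.  For \<open>W = {}\<close> this shows that the intersection is
  nonempty.  For connectedness, a separation of the intersection would extend, by normality
  of compact Hausdorff spaces, to two disjoint open sets, whose union then contains and
  separates a member of the chain.
\<close>

lemma compact_chain_Inter_subset_open:
  assumes "compact_space X" and "\<C> \<noteq> {}"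
    and clo: "\<And>C. C \<in> \<C> \<Longrightarrow> closedin X C"
    and chain: "subset.chain UNIV \<C>"
    and W: "openin X W" "\<Inter>\<C> \<subseteq> W"
  shows "\<exists>C\<in>\<C>. C \<subseteq> W"
proof (rule ccontr)
  \<comment> \<open>Otherwise the traces of the chain outside \<open>W\<close> form a chain of nonempty closed sets with
    empty intersection.\<close>
  assume "\<not> (\<exists>C\<in>\<C>. C \<subseteq> W)"
  then have ne: "C - W \<noteq> {}" if "C \<in> \<C>" for C
    using that by blast
  let ?\<D> = "(\<lambda>C. C - W) ` \<C>"
  have "\<Inter>\<F> \<noteq> {}" if "finite \<F>" "\<F> \<subseteq> ?\<D>" for \<F>
  proof (cases "\<F> = {}")
    case False
    have "subset.chain ?\<D> \<F>"
      unfolding subset_chain_def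
    proof (intro conjI ballI)
      fix S T assume "S \<in> \<F>" "T \<in> \<F>"
      then obtain C D where "C \<in> \<C>" "S = C - W" "D \<in> \<C>" "T = D - W"
        using \<open>\<F> \<subseteq> ?\<D>\<close> by blast
      moreover have "C \<subseteq> D \<or> D \<subseteq> C"
        using chain \<open>C \<in> \<C>\<close> \<open>D \<in> \<C>\<close> by (auto simp: subset_chain_def)
      ultimately show "S \<subseteq> T \<or> T \<subseteq> S"
        by blast
    qed fact
    then have "\<Inter>\<F> \<in> ?\<D>"
      using Inter_in_chain \<open>finite \<F>\<close> False \<open>\<F> \<subseteq> ?\<D>\<close> by blast
    then show ?thesis
      using ne by auto
  qed simp
  moreover have "closedin X D" if "D \<in> ?\<D>" for D
    using that clo \<open>openin X W\<close> by (auto intro: closedin_diff)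
  ultimately have "\<Inter>?\<D> \<noteq> {}"
    using \<open>compact_space X\<close>[unfolded compact_space_fip, rule_format, of ?\<D>] by simp
  then show False
    using \<open>\<C> \<noteq> {}\<close> \<open>\<Inter>\<C> \<subseteq> W\<close> by blast
qed

lemma connectedin_chain_Inter:
  assumes X: "compact_space X" "Hausdorff_space X" and "\<C> \<noteq> {}"
    and C: "\<And>C. C \<in> \<C> \<Longrightarrow> closedin X C \<and> connectedin X C"
    and chain: "subset.chain UNIV \<C>"
  shows "connectedin X (\<Inter>\<C>)"
proof -
  have clo: "closedin X (\<Inter>\<C>)"
    using \<open>\<C> \<noteq> {}\<close> C by blast
  have False
    if E: "closedin X E1" "closedin X E2" "\<Inter>\<C> \<subseteq> E1 \<union> E2" "E1 \<inter> E2 \<inter> \<Inter>\<C> = {}"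
      and ne: "E1 \<inter> \<Inter>\<C> \<noteq> {}" "E2 \<inter> \<Inter>\<C> \<noteq> {}" for E1 E2
  proof -
    have "normal_space X"
      using X compact_Hausdorff_or_regular_imp_normal_space by blast
    moreover have "closedin X (E1 \<inter> \<Inter>\<C>)" "closedin X (E2 \<inter> \<Inter>\<C>)"
      using E clo by (auto intro: closedin_Int)
    moreover have "disjnt (E1 \<inter> \<Inter>\<C>) (E2 \<inter> \<Inter>\<C>)"
      using E(4) unfolding disjnt_def by blast
    ultimately obtain U V where UV: "openin X U" "openin X V"
        "E1 \<inter> \<Inter>\<C> \<subseteq> U" "E2 \<inter> \<Inter>\<C> \<subseteq> V" "disjnt U V"
      unfolding normal_space_def by meson
    have "openin X (U \<union> V)" "\<Inter>\<C> \<subseteq> U \<union> V"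
      using UV E(3) by auto
    then obtain C where "C \<in> \<C>" "C \<subseteq> U \<union> V"
      using compact_chain_Inter_subset_open[OF X(1) \<open>\<C> \<noteq> {}\<close> _ chain] assms(4) by metis
    moreover have "U \<inter> C \<noteq> {}" "V \<inter> C \<noteq> {}"
      using ne UV \<open>C \<in> \<C>\<close> by blast+
    moreover have "U \<inter> V \<inter> C = {}"
      using \<open>disjnt U V\<close> by (auto simp: disjnt_def)
    moreover have "connectedin X C"
      using C \<open>C \<in> \<C>\<close> by blast
    ultimately show False
      using UV(1,2) unfolding connectedin by blast
  qed
  then show ?thesis
    using closedin_subset[OF clo] unfolding connectedin_closedin by blast
qed

lemma continuumin_iff_closedin_connectedin:
  assumes "compact_space X" "Hausdorff_space X"
  shows "continuumin X K \<longleftrightarrow> K \<noteq> {} \<and> closedin X K \<and> connectedin X K"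
proof -
  have "compactin X K \<longleftrightarrow> closedin X K"
    using assms closedin_compact_space compactin_imp_closedin by blast
  moreover have "topspace (subtopology X K) = K" if "K \<subseteq> topspace X"
    using that by auto
  ultimately show ?thesis
    using assms(2) unfolding continuumin_def continuum_space_def connectedin_def
    by (auto simp: compactin_subspace Hausdorff_space_subtopology dest: closedin_subset)
qed

lemma continuumin_chain_Inter:
  assumes X: "compact_space X" "Hausdorff_space X" and "\<C> \<noteq> {}"
    and C: "\<And>C. C \<in> \<C> \<Longrightarrow> continuumin X C"
    and chain: "subset.chain UNIV \<C>"
  shows "continuumin X (\<Inter>\<C>)"
proof -
  note iff = continuumin_iff_closedin_connectedin[OF X]
  have clo: "closedin X C" and ne: "C \<noteq> {}" and conn: "connectedin X C" if "C \<in> \<C>" for C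
    using C[OF that] iff by auto
  have "\<Inter>\<C> \<noteq> {}"
    using compact_chain_Inter_subset_open[OF X(1) \<open>\<C> \<noteq> {}\<close> clo chain openin_empty] ne by blast
  moreover have "closedin X (\<Inter>\<C>)"
    using \<open>\<C> \<noteq> {}\<close> clo by blast
  moreover have "connectedin X (\<Inter>\<C>)"
    using connectedin_chain_Inter[OF X \<open>\<C> \<noteq> {}\<close> _ chain] clo conn by blast
  ultimately show ?thesis
    using iff by blast
qed

lemma continuumin_continuous_map_image:
  assumes "Hausdorff_space Y" "continuous_map X Y f" "continuumin X K"
  shows "continuumin Y (f ` K)"
proof -
  have K: "K \<noteq> {}" "compactin X K" "connectedin X K"
    using assms(3) unfolding continuumin_def continuum_space_def
    by (auto simp: compactin_subspace connectedin_def)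
  have im: "compactin Y (f ` K)" "connectedin Y (f ` K)"
    using image_compactin[OF K(2) assms(2)]
      connectedin_continuous_map_image[OF assms(2) K(3)] by auto
  then have "f ` K \<subseteq> topspace Y"
    using compactin_subset_topspace by blast
  then show ?thesis
    using K(1) im assms(1) unfolding continuumin_def continuum_space_def
    by (auto simp: compactin_subspace connectedin_def Hausdorff_space_subtopology)
qed

theorem corollary5p10:
  fixes X :: "'a topology" and f :: "'a \<Rightarrow> 'a"
  assumes "continuum_space X"
    and "continuous_map X X f"
  shows "\<exists>K. continuumin X K \<and> f ` K = K"
proof -
  have X: "compact_space X" "Hausdorff_space X"
    using assms(1) by (auto simp: continuum_space_def)
  define \<A> where "\<A> = {K. continuumin X K \<and> f ` K \<subseteq> K}"
  have "topspace X \<in> \<A>"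
    using assms continuous_map_image_subset_topspace[OF assms(2)]
    by (simp add: \<A>_def continuumin_def subtopology_topspace)
  have "\<exists>M\<in>\<A>. \<forall>K\<in>\<A>. M \<supseteq> K \<longrightarrow> K = M"
  proof (rule predicate_Zorn)
    show "partial_order_on \<A> (relation_of (\<supseteq>) \<A>)"
      by (rule partial_order_on_relation_ofI) auto
  next
    fix \<C> assume "\<C> \<in> Chains (relation_of (\<supseteq>) \<A>)"
    then have "\<C> \<subseteq> \<A>" and chain: "subset.chain UNIV \<C>"
      by (auto simp: Chains_def relation_of_def subset_chain_def)
    show "\<exists>L\<in>\<A>. \<forall>K\<in>\<C>. K \<supseteq> L"
    proof (cases "\<C> = {}")
      case True
      then show ?thesis
        using \<open>topspace X \<in> \<A>\<close> by blast
    next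
      case False
      have "continuumin X (\<Inter>\<C>)"
        using continuumin_chain_Inter[OF X False _ chain] \<open>\<C> \<subseteq> \<A>\<close> by (auto simp: \<A>_def)
      moreover have "f ` \<Inter>\<C> \<subseteq> \<Inter>\<C>"
        using \<open>\<C> \<subseteq> \<A>\<close> by (fastforce simp: \<A>_def)
      ultimately have "\<Inter>\<C> \<in> \<A>"
        by (simp add: \<A>_def)
      then show ?thesis
        by blast
    qed
  qed
  then obtain M where M: "M \<in> \<A>" and min: "\<And>K. K \<in> \<A> \<Longrightarrow> K \<subseteq> M \<Longrightarrow> K = M"
    by blast
  have "f ` M \<in> \<A>"
    using M continuumin_continuous_map_image[OF X(2) assms(2)]
    by (auto simp: \<A>_def intro: image_mono)
  then have "f ` M = M"
    using M min by (simp add: \<A>_def)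
  then show ?thesis
    using M by (auto simp: \<A>_def)
qed

end
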